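(* Let $\mathcal{I} = (F, C, d, f, B)$ be an LBFL instance, $\beta \in (1/2,1)$, and let $(S^\circ, \sigma^\circ)$ be a $\beta$-covered solution to $\mathcal{I}$ with $\mathrm{cost}_{\mathcal{I}}(S^\circ, \sigma^\circ) \le \frac{2}{1-\beta}\mathrm{OPT}(\mathcal{I})$ and such that $\sigma^\circ_j$ is a nearest facility of $S^\circ$ to $j$ for all $j \in C$. Let $\mathcal{I}^1 = (F, C, d^1, f^1, B)$ be the LBFL instance with $d^1(i,i') = d(i,i')$ for $i, i' \in F$, $d^1(i, j) = d(i, \sigma^\circ_j)$ for $i \in F, j \in C$, $d^1(j, j') = d(\sigma^\circ_j, \sigma^\circ_{j'})$ for $j, j' \in C$, and $f^1_i = 0$ if $i \in S^\circ$, $f^1_i = f_i$ otherwise. Given an $\alpha_1$-approximate solution to $\mathcal{I}^1$, one can in polynomial time find an $\alpha$-approximate solution to $\mathcal{I}$, where $\alpha = \alpha_1\left(1 + \frac{2}{1-\beta}\right) + \frac{2}{1-\beta}$.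
   Context: An LBFL instance $(F, C, d, f, B)$: finite sets $F$ (facilities), $C$ (clients), a (pseudo)metric $d$ on $F\cup C$ (distinct points may be at distance $0$), opening costs $f_i \ge 0$, lower bounds $B_i \in \mathbb{Z}_{\ge0}$. A $\beta$-covered solution is $(S \subseteq F, \sigma \in S^C)$ with $|\{j: \sigma_j = i\}| \ge \beta B_i$ for all $i \in S$; a valid solution is a $1$-covered one. Cost: $\mathrm{cost}_{\mathcal{I}}(S,\sigma) = \sum_{i\in S} f_i + \sum_{j\in C} d(j,\sigma_j)$; $\mathrm{OPT}(\mathcal{I})$ is the minimum cost of a valid solution. An $\alpha$-approximate solution is a valid solution of cost at most $\alpha\cdot\mathrm{OPT}$. *)

theory Defs
  imports
    Complex_Main
    "HOL-Library.FuncSet"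
    "HOL-Computational_Algebra.Polynomial"
begin

section \<open>Facility location with lower bounds\<close>

text \<open>Facilities and clients are kept apart by the sum type, so a facility and a client may share
  a location only through distance \<open>0\<close>. Outside the instance the components are irrelevant.\<close>

record ('f, 'c) lbfl =
  facs :: "'f set"
  clients :: "'c set"
  distance :: "'f + 'c \<Rightarrow> 'f + 'c \<Rightarrow> real"
  fac_cost :: "'f \<Rightarrow> real"
  lower :: "'f \<Rightarrow> nat"

definition points :: "('f, 'c) lbfl \<Rightarrow> ('f + 'c) set" where
  "points I = Inl ` facs I \<union> Inr ` clients I"

definition pseudometric_on :: "'a set \<Rightarrow> ('a \<Rightarrow> 'a \<Rightarrow> real) \<Rightarrow> bool" where
  "pseudometric_on X m \<longleftrightarrow>
     (\<forall>x\<in>X. m x x = 0) \<and>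
     (\<forall>x\<in>X. \<forall>y\<in>X. 0 \<le> m x y \<and> m x y = m y x) \<and>
     (\<forall>x\<in>X. \<forall>y\<in>X. \<forall>z\<in>X. m x z \<le> m x y + m y z)"

definition lbfl_instance :: "('f, 'c) lbfl \<Rightarrow> bool" where
  "lbfl_instance I \<longleftrightarrow>
     finite (facs I) \<and> finite (clients I) \<and> pseudometric_on (points I) (distance I) \<and>
     (\<forall>i\<in>facs I. 0 \<le> fac_cost I i)"

type_synonym ('f, 'c) solution = "'f set \<times> ('c \<Rightarrow> 'f)"

text \<open>\<open>\<sigma> \<in> S\<^sup>C\<close> is rendered by the extensional function space, so that there are only
  finitely many solutions.\<close>

definition solutions :: "('f, 'c) lbfl \<Rightarrow> ('f, 'c) solution set" where
  "solutions I = {(S, \<sigma>). S \<subseteq> facs I \<and> \<sigma> \<in> clients I \<rightarrow>\<^sub>E S}"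

definition covered_solutions :: "real \<Rightarrow> ('f, 'c) lbfl \<Rightarrow> ('f, 'c) solution set" where
  "covered_solutions \<beta> I =
     {(S, \<sigma>) \<in> solutions I. \<forall>i\<in>S. real (card {j \<in> clients I. \<sigma> j = i}) \<ge> \<beta> * real (lower I i)}"

definition valid_solutions :: "('f, 'c) lbfl \<Rightarrow> ('f, 'c) solution set" where
  "valid_solutions I = covered_solutions 1 I"

fun cost :: "('f, 'c) lbfl \<Rightarrow> ('f, 'c) solution \<Rightarrow> real" where
  "cost I (S, \<sigma>) = (\<Sum>i\<in>S. fac_cost I i) + (\<Sum>j\<in>clients I. distance I (Inr j) (Inl (\<sigma> j)))"

text \<open>The set is finite by extensionality. The value is unspecified if \<open>I\<close> has no valid solution;
  validity depends only on facilities, clients and lower bounds.\<close>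

definition OPT :: "('f, 'c) lbfl \<Rightarrow> real" where
  "OPT I = Min (cost I ` valid_solutions I)"

definition approx_solutions :: "real \<Rightarrow> ('f, 'c) lbfl \<Rightarrow> ('f, 'c) solution set" where
  "approx_solutions \<alpha> I = {s \<in> valid_solutions I. cost I s \<le> \<alpha> * OPT I}"

fun nearest_assignment :: "('f, 'c) lbfl \<Rightarrow> ('f, 'c) solution \<Rightarrow> bool" where
  "nearest_assignment I (S, \<sigma>) \<longleftrightarrow>
     (\<forall>j\<in>clients I. \<sigma> j \<in> S \<and> (\<forall>i\<in>S. distance I (Inr j) (Inl (\<sigma> j)) \<le> distance I (Inr j) (Inl i)))"

text \<open>Each client is moved to its facility in \<open>(S, \<sigma>)\<close>, and the facilities of \<open>S\<close> become
  free.\<close>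

fun moved_instance :: "('f, 'c) lbfl \<Rightarrow> ('f, 'c) solution \<Rightarrow> ('f, 'c) lbfl" where
  "moved_instance I (S, \<sigma>) = I\<lparr>
     distance := (\<lambda>x y. case (x, y) of
         (Inl i, Inl i') \<Rightarrow> distance I (Inl i) (Inl i')
       | (Inl i, Inr j) \<Rightarrow> distance I (Inl i) (Inl (\<sigma> j))
       | (Inr j, Inl i) \<Rightarrow> distance I (Inl i) (Inl (\<sigma> j))
       | (Inr j, Inr j') \<Rightarrow> distance I (Inl (\<sigma> j)) (Inl (\<sigma> j'))),
     fac_cost := (\<lambda>i. if i \<in> S then 0 else fac_cost I i)\<rparr>"

lemma lbfl_instance_moved_instance:
  assumes "lbfl_instance I" and "s \<in> solutions I"
  shows "lbfl_instance (moved_instance I s)"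
proof -
  obtain S \<sigma> where s: "s = (S, \<sigma>)" by (cases s)
  define loc where "loc = (\<lambda>x. case x of Inl i \<Rightarrow> i | Inr j \<Rightarrow> \<sigma> j)"
  have loc: "Inl (loc x) \<in> points I" if "x \<in> points I" for x
    using that assms(2) by (auto simp: s points_def solutions_def loc_def)
  have pm: "pseudometric_on (points I) (distance I)"
    using assms(1) by (simp add: lbfl_instance_def)
  have eq: "distance (moved_instance I s) x y = distance I (Inl (loc x)) (Inl (loc y))"
    if "x \<in> points I" "y \<in> points I" for x y
    using loc[OF that(1)] loc[OF that(2)] pm
    by (auto simp: s loc_def pseudometric_on_def split: sum.splits)
  have pts: "points (moved_instance I s) = points I"
    by (simp add: points_def s)
  have "pseudometric_on (points I) (distance (moved_instance I s))"
    using pm loc by (simp add: pseudometric_on_def eq)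
  then show ?thesis
    using assms(1) unfolding lbfl_instance_def pts by (simp add: s)
qed


section \<open>Deterministic multi-tape Turing machines and polynomial time\<close>

text \<open>Symbols are natural numbers, with \<open>0\<close> as the blank. Tapes are infinite to the right; a left
  move on cell \<open>0\<close> has no effect. A machine is a finite list of commands, one per state, started
  in state \<open>0\<close> and halting in state \<open>length M\<close>. Tape \<open>0\<close> holds the input and
  the last tape the output.\<close>

type_synonym symbol = nat

datatype move = Left | Stay | Right

type_synonym tape = "(nat \<Rightarrow> symbol) \<times> nat"

type_synonym command = "symbol list \<Rightarrow> nat \<times> (symbol \<times> move) list"

type_synonym machine = "command list"

type_synonym config = "nat \<times> tape list"

definition turing_machine :: "nat \<Rightarrow> nat \<Rightarrow> machine \<Rightarrow> bool" where
  "turing_machine k G M \<longleftrightarrow> k \<ge> 2 \<and>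
     (\<forall>cmd\<in>set M. \<forall>rs. length rs = k \<and> set rs \<subseteq> {..<G} \<longrightarrow>
        (case cmd rs of (q, acts) \<Rightarrow>
           q \<le> length M \<and> length acts = k \<and> fst ` set acts \<subseteq> {..<G}))"

fun act :: "symbol \<times> move \<Rightarrow> tape \<Rightarrow> tape" where
  "act (a, m) (t, p) = (t(p := a), (case m of Left \<Rightarrow> p - 1 | Stay \<Rightarrow> p | Right \<Rightarrow> p + 1))"

fun step :: "machine \<Rightarrow> config \<Rightarrow> config" where
  "step M (q, ts) =
     (if q < length M
      then (case (M ! q) (map (\<lambda>(t, p). t p) ts) of (q', acts) \<Rightarrow> (q', map2 act acts ts))
      else (q, ts))"

definition tape_of :: "symbol list \<Rightarrow> nat \<Rightarrow> symbol" where
  "tape_of w = (\<lambda>p. if p < length w then w ! p else 0)"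

definition start_config :: "nat \<Rightarrow> symbol list \<Rightarrow> config" where
  "start_config k w = (0, (tape_of w, 0) # replicate (k - 1) (tape_of [], 0))"

definition computes_within :: "nat \<Rightarrow> machine \<Rightarrow> symbol list \<Rightarrow> symbol list \<Rightarrow> nat \<Rightarrow> bool" where
  "computes_within k M w v T \<longleftrightarrow>
     (\<exists>t\<le>T. case (step M ^^ t) (start_config k w) of (q, ts) \<Rightarrow>
        q = length M \<and> fst (last ts) = tape_of v)"

text \<open>\<open>inp x\<close> is the input string of \<open>x \<in> D\<close> and \<open>out x\<close> the required output string. The
  running time is measured in the length of the input string.\<close>

definition polytime_on :: "'x set \<Rightarrow> ('x \<Rightarrow> symbol list) \<Rightarrow> ('x \<Rightarrow> symbol list) \<Rightarrow> bool" where
  "polytime_on D inp out \<longleftrightarrow>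
     (\<exists>k G M. \<exists>p :: nat poly. turing_machine k G M \<and>
        (\<forall>x\<in>D. set (inp x) \<subseteq> {0<..<G} \<and> set (out x) \<subseteq> {0<..<G} \<and>
           computes_within k M (inp x) (out x) (poly p (length (inp x)))))"


section \<open>Encoding of instances and solutions\<close>

text \<open>Binary digits are the symbols \<open>1\<close> and \<open>2\<close>; \<open>3\<close> ends an entry, \<open>4\<close> a section,
  \<open>5\<close> a component of the input, and \<open>6\<close> separates numerator and denominator. Facilities and
  clients are named by natural numbers.\<close>

fun bin :: "nat \<Rightarrow> symbol list" where
  "bin n = (if n < 2 then [n + 1] else bin (n div 2) @ [n mod 2 + 1])"

declare bin.simps [simp del]

text \<open>Only used for nonnegative rational numbers.\<close>

definition enc_rat :: "real \<Rightarrow> symbol list" where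
  "enc_rat x = (case quotient_of (inv of_rat x) of (a, b) \<Rightarrow> bin (nat a) @ [6] @ bin (nat b))"

definition enc_section :: "symbol list list \<Rightarrow> symbol list" where
  "enc_section ws = concat (map (\<lambda>w. w @ [3]) ws) @ [4]"

definition enc_instance :: "(nat, nat) lbfl \<Rightarrow> symbol list" where
  "enc_instance I =
     (let Fs = sorted_list_of_set (facs I);
          Cs = sorted_list_of_set (clients I);
          Ps = map Inl Fs @ map Inr Cs
      in enc_section (map bin Fs) @
         enc_section (map bin Cs) @
         enc_section [enc_rat (distance I x y). x \<leftarrow> Ps, y \<leftarrow> Ps] @
         enc_section (map (\<lambda>i. enc_rat (fac_cost I i)) Fs) @
         enc_section (map (\<lambda>i. bin (lower I i)) Fs))"

fun enc_solution :: "(nat, nat) lbfl \<Rightarrow> (nat, nat) solution \<Rightarrow> symbol list" where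
  "enc_solution I (S, \<sigma>) =
     enc_section (map bin (sorted_list_of_set S)) @
     enc_section (map (\<lambda>j. bin (\<sigma> j)) (sorted_list_of_set (clients I)))"

type_synonym lbfl_input = "(nat, nat) lbfl \<times> (nat, nat) solution \<times> (nat, nat) solution"

fun enc_input :: "lbfl_input \<Rightarrow> symbol list" where
  "enc_input (I, s, s') =
     enc_instance I @ [5] @ enc_solution I s @ [5] @ enc_solution I s' @ [5]"

definition rational_instance :: "('f, 'c) lbfl \<Rightarrow> bool" where
  "rational_instance I \<longleftrightarrow> lbfl_instance I \<and>
     (\<forall>x\<in>points I. \<forall>y\<in>points I. distance I x y \<in> \<rat>) \<and> (\<forall>i\<in>facs I. fac_cost I i \<in> \<rat>)"

text \<open>The well-formed inputs that can be written down: an instance with rational data and two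
  solutions of it. These are also solutions of every instance with the same facilities and clients.\<close>

definition rational_inputs :: "lbfl_input set" where
  "rational_inputs =
     {(I, s, s'). rational_instance I \<and> s \<in> solutions I \<and> s' \<in> solutions I}"

end

(* The algorithm returns the given solution of the moved instance unchanged. Moving every client
   to its facility in the bicriteria solution costs at most the connection cost of that solution,
   in either direction, and the facility costs that were set to 0 are bounded by its opening cost.
   Hence passing to the moved instance raises the optimum by at most cost(s0), and passing back
   raises the cost of a solution by at most cost(s0). On the machine side it remains to copy the
   last component of the input to the output tape. *)

theory Submission
  imports Defs
begin

section \<open>Costs in the moved instance\<close>

text \<open>This makes the \<open>Min\<close> in \<open>OPT\<close> meaningful. The assignments for
  the various opened sets all lie in one extensional function space with codomain
  \<open>facs I\<close>.\<close>

lemma finite_solutions: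
  assumes "lbfl_instance I"
  shows "finite (solutions I)"
proof (rule finite_subset)
  show "solutions I \<subseteq> Pow (facs I) \<times> (clients I \<rightarrow>\<^sub>E facs I)"
    unfolding solutions_def using PiE_mono[of "clients I" "\<lambda>_. _" "\<lambda>_. facs I"] by fast
  show "finite (Pow (facs I) \<times> (clients I \<rightarrow>\<^sub>E facs I))"
    using assms by (auto simp: lbfl_instance_def intro: finite_PiE)
qed

lemma valid_solutions_subset: "valid_solutions I \<subseteq> solutions I"
  by (auto simp: valid_solutions_def covered_solutions_def)

lemma valid_solutions_moved_instance [simp]:
  "valid_solutions (moved_instance I s) = valid_solutions I"
  by (cases s) (simp add: valid_solutions_def covered_solutions_def solutions_def)

lemma OPT_le_cost:
  assumes "lbfl_instance I" "s \<in> valid_solutions I"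
  shows "OPT I \<le> cost I s"
  unfolding OPT_def using assms finite_subset[OF valid_solutions_subset finite_solutions]
  by (intro Min_le) auto

lemma OPT_attained:
  assumes "lbfl_instance I" "valid_solutions I \<noteq> {}"
  obtains s where "s \<in> valid_solutions I" "OPT I = cost I s"
proof -
  have "OPT I \<in> cost I ` valid_solutions I"
    unfolding OPT_def using assms finite_subset[OF valid_solutions_subset finite_solutions]
    by (intro Min_in) auto
  then show thesis using that by auto
qed

text \<open>In the moved instance, \<open>j\<close> pays the distance from
  \<open>\<sigma>0 j\<close> to \<open>\<sigma> j\<close>. By the triangle inequality this differs
  from its original distance by at most the distance from \<open>j\<close> to
  \<open>\<sigma>0 j\<close>. Opening costs can only drop, by at most the opening cost of
  \<open>S0\<close>.\<close>

lemma moved_instance_cost_bounds: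
  assumes I: "lbfl_instance I" and s0: "s0 \<in> solutions I" and s: "s \<in> solutions I"
  shows "cost (moved_instance I s0) s \<le> cost I s + cost I s0"
    and "cost I s \<le> cost (moved_instance I s0) s + cost I s0"
proof -
  obtain S0 \<sigma>0 S \<sigma> where eq: "s0 = (S0, \<sigma>0)" "s = (S, \<sigma>)"
    by (cases s0, cases s)
  let ?d = "distance I" and ?f = "fac_cost I"
  let ?f1 = "\<lambda>i. if i \<in> S0 then 0 else ?f i"
  have sub: "S0 \<subseteq> facs I" "S \<subseteq> facs I"
    using s0 s by (auto simp: eq solutions_def)
  have fin: "finite S0" "finite S"
    using sub I by (auto simp: lbfl_instance_def intro: finite_subset)
  have f0: "0 \<le> ?f i" if "i \<in> S0 \<union> S" for i
    using that sub I by (auto simp: lbfl_instance_def)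
  have d: "?d (Inl (\<sigma> j)) (Inl (\<sigma>0 j)) \<le> ?d (Inr j) (Inl (\<sigma> j)) + ?d (Inr j) (Inl (\<sigma>0 j))
      \<and> ?d (Inr j) (Inl (\<sigma> j)) \<le> ?d (Inl (\<sigma> j)) (Inl (\<sigma>0 j)) + ?d (Inr j) (Inl (\<sigma>0 j))
      \<and> 0 \<le> ?d (Inr j) (Inl (\<sigma>0 j))"
    if "j \<in> clients I" for j
  proof -
    have pts: "Inr j \<in> points I" "Inl (\<sigma> j) \<in> points I" "Inl (\<sigma>0 j) \<in> points I"
      using that s0 s sub by (auto simp: eq solutions_def points_def)
    have "pseudometric_on (points I) ?d"
      using I by (simp add: lbfl_instance_def)
    then have sym: "\<And>x y. x \<in> points I \<Longrightarrow> y \<in> points I \<Longrightarrow> 0 \<le> ?d x y \<and> ?d x y = ?d y x"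
      and tri: "\<And>x y z. x \<in> points I \<Longrightarrow> y \<in> points I \<Longrightarrow> z \<in> points I
          \<Longrightarrow> ?d x z \<le> ?d x y + ?d y z"
      unfolding pseudometric_on_def by blast+
    show ?thesis
      using tri[OF pts(2) pts(1) pts(3)] tri[OF pts(1) pts(3) pts(2)]
        sym[OF pts(1) pts(2)] sym[OF pts(1) pts(3)] sym[OF pts(2) pts(3)] by linarith
  qed
  have c: "cost (moved_instance I s0) s
      = (\<Sum>i\<in>S. ?f1 i) + (\<Sum>j\<in>clients I. ?d (Inl (\<sigma> j)) (Inl (\<sigma>0 j)))"
    by (simp add: eq)
  have "(\<Sum>j\<in>clients I. ?d (Inl (\<sigma> j)) (Inl (\<sigma>0 j)))
      \<le> (\<Sum>j\<in>clients I. ?d (Inr j) (Inl (\<sigma> j))) + (\<Sum>j\<in>clients I. ?d (Inr j) (Inl (\<sigma>0 j)))"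
    unfolding sum.distrib[symmetric] using d by (intro sum_mono) blast
  moreover have "(\<Sum>i\<in>S. ?f1 i) \<le> (\<Sum>i\<in>S. ?f i)"
    using f0 by (intro sum_mono) auto
  \<comment> \<open>In this direction the opening part of \<open>cost I s0\<close> is pure slack, so
    its sign suffices.\<close>
  moreover have "0 \<le> (\<Sum>i\<in>S0. ?f i)"
    using f0 by (intro sum_nonneg) auto
  ultimately show "cost (moved_instance I s0) s \<le> cost I s + cost I s0"
    unfolding c by (simp add: eq)
  have "(\<Sum>j\<in>clients I. ?d (Inr j) (Inl (\<sigma> j)))
      \<le> (\<Sum>j\<in>clients I. ?d (Inl (\<sigma> j)) (Inl (\<sigma>0 j))) + (\<Sum>j\<in>clients I. ?d (Inr j) (Inl (\<sigma>0 j)))"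
    unfolding sum.distrib[symmetric] using d by (intro sum_mono) blast
  \<comment> \<open>The second sum collects the costs set to zero by the move; they belong to
    facilities of \<open>S0\<close>.\<close>
  moreover have "(\<Sum>i\<in>S. ?f i) = (\<Sum>i\<in>S. ?f1 i) + (\<Sum>i\<in>S. if i \<in> S0 then ?f i else 0)"
    unfolding sum.distrib[symmetric] by (intro sum.cong) auto
  moreover have "(\<Sum>i\<in>S. if i \<in> S0 then ?f i else 0) = (\<Sum>i\<in>S \<inter> S0. ?f i)"
    using fin by (simp add: sum.inter_restrict)
  moreover have "(\<Sum>i\<in>S \<inter> S0. ?f i) \<le> (\<Sum>i\<in>S0. ?f i)"
    using fin f0 by (intro sum_mono2) auto
  ultimately show "cost I s \<le> cost (moved_instance I s0) s + cost I s0"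
    unfolding c by (simp add: eq)
qed

text \<open>An optimal solution of \<open>I\<close>, read in the moved instance, bounds the optimum
  there by \<open>(1 + \<gamma>) * OPT I\<close>. Reading \<open>s\<close> back in \<open>I\<close>
  then adds at most \<open>\<gamma> * OPT I\<close>.\<close>

lemma approx_solution_of_moved_instance:
  assumes I: "lbfl_instance I" and s0: "s0 \<in> solutions I" and "0 \<le> \<alpha>"
    and cost0: "cost I s0 \<le> \<gamma> * OPT I"
    and s: "s \<in> approx_solutions \<alpha> (moved_instance I s0)"
  shows "s \<in> approx_solutions (\<alpha> * (1 + \<gamma>) + \<gamma>) I"
proof -
  have valid: "s \<in> valid_solutions I"
    and s_cost: "cost (moved_instance I s0) s \<le> \<alpha> * OPT (moved_instance I s0)"
    using s by (auto simp: approx_solutions_def)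
  \<comment> \<open>The minimum is attained because \<open>s\<close> itself shows that valid
    solutions of \<open>I\<close> exist.\<close>
  obtain t where t: "t \<in> valid_solutions I" "OPT I = cost I t"
    using OPT_attained[OF I] valid by blast
  have "OPT (moved_instance I s0) \<le> cost (moved_instance I s0) t"
    using OPT_le_cost[OF lbfl_instance_moved_instance[OF I s0]] t(1) by simp
  also have "\<dots> \<le> OPT I + cost I s0"
    using moved_instance_cost_bounds(1)[OF I s0] t valid_solutions_subset by fastforce
  also have "\<dots> \<le> (1 + \<gamma>) * OPT I"
    using cost0 by (simp add: algebra_simps)
  finally have "\<alpha> * OPT (moved_instance I s0) \<le> \<alpha> * ((1 + \<gamma>) * OPT I)"
    using \<open>0 \<le> \<alpha>\<close> by (rule mult_left_mono)
  moreover have "cost I s \<le> cost (moved_instance I s0) s + cost I s0"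
    using moved_instance_cost_bounds(2)[OF I s0] valid valid_solutions_subset by blast
  ultimately have "cost I s \<le> (\<alpha> * (1 + \<gamma>) + \<gamma>) * OPT I"
    using s_cost cost0 by (simp add: algebra_simps)
  with valid show ?thesis
    by (simp add: approx_solutions_def)
qed


section \<open>A machine that copies the third component of its input\<close>

text \<open>Every command must write on each tape, so writing back the symbol just read leaves a
  tape unchanged. The symbol \<open>5\<close> is the end mark of a component.\<close>

definition skip_command :: "nat \<Rightarrow> command" where
  "skip_command q = (\<lambda>rs. (if rs ! 0 = 5 then Suc q else q, [(rs ! 0, Right), (rs ! 1, Stay)]))"

text \<open>State \<open>3\<close> is the halting state, as \<open>copy_machine\<close> has three
  commands. The end mark is not copied.\<close>

definition copy_command :: command where
  "copy_command = (\<lambda>rs. if rs ! 0 = 5 then (3, [(rs ! 0, Stay), (rs ! 1, Stay)])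
     else (2, [(rs ! 0, Right), (rs ! 0, Right)]))"

definition copy_machine :: machine where
  "copy_machine = [skip_command 0, skip_command 1, copy_command]"

text \<open>The alphabet size is \<open>7\<close> because the encoding uses symbols up to
  \<open>6\<close>.\<close>

lemma turing_machine_copy: "turing_machine 2 7 copy_machine"
proof -
  have "rs ! 0 < 7 \<and> rs ! 1 < 7" if "length rs = 2" "set rs \<subseteq> {..<7}" for rs :: "nat list"
    using that nth_mem[of 0 rs] nth_mem[of 1 rs] by force
  then show ?thesis
    by (auto simp: turing_machine_def copy_machine_def skip_command_def copy_command_def)
qed

lemma tape_of_append_Cons [simp]: "tape_of (u @ a # v) (length u) = a"
  by (simp add: tape_of_def)

lemma tape_of_upd_same [simp]: "(tape_of (u @ a # v))(length u := a) = tape_of (u @ a # v)"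
  by (simp add: fun_upd_idem)

lemma tape_of_snoc: "(tape_of z)(length z := a) = tape_of (z @ [a])"
  by (auto simp: tape_of_def fun_eq_iff nth_append)

text \<open>The prefix \<open>u\<close> is what the head has passed; the induction shifts the first
  symbol of \<open>w\<close> into it. The extra step passes the end mark.\<close>

lemma skip_component:
  assumes "q < 2" "5 \<notin> set w"
  shows "(step copy_machine ^^ Suc (length w)) (q, [(tape_of (u @ w @ 5 # v), length u), tp])
    = (Suc q, [(tape_of (u @ w @ 5 # v), length (u @ w @ [5])), tp])"
  using assms(2)
proof (induction w arbitrary: u)
  case Nil
  have "q = 0 \<or> q = 1" using assms(1) by auto
  then show ?case
    by (cases tp) (auto simp: copy_machine_def skip_command_def)
next
  case (Cons a w)
  have "q = 0 \<or> q = 1" using assms(1) by auto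
  then have "step copy_machine (q, [(tape_of (u @ (a # w) @ 5 # v), length u), tp])
      = (q, [(tape_of ((u @ [a]) @ w @ 5 # v), length (u @ [a])), tp])"
    using Cons.prems by (cases tp) (auto simp: copy_machine_def skip_command_def)
  \<comment> \<open>\<open>funpow_swap1\<close> brings the outermost step to the front, where the
    one-step equation applies.\<close>
  then show ?case
    using Cons.IH[of "u @ [a]"] Cons.prems by (simp add: funpow_swap1 del: step.simps)
qed

text \<open>Here \<open>z\<close> is the output so far. The output head stands on the first blank
  after it, so each write appends a symbol. The final head positions are irrelevant to the
  output.\<close>

lemma copy_component:
  assumes "5 \<notin> set w"
  shows "\<exists>p p'. (step copy_machine ^^ Suc (length w))
      (2, [(tape_of (u @ w @ 5 # v), length u), (tape_of z, length z)])
    = (3, [(tape_of (u @ w @ 5 # v), p), (tape_of (z @ w), p')])"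
  using assms
proof (induction w arbitrary: u z)
  case Nil
  show ?case
    by (simp add: copy_machine_def copy_command_def)
next
  case (Cons a w)
  have "step copy_machine (2, [(tape_of (u @ (a # w) @ 5 # v), length u), (tape_of z, length z)])
      = (2, [(tape_of ((u @ [a]) @ w @ 5 # v), length (u @ [a])),
             (tape_of (z @ [a]), length (z @ [a]))])"
    using Cons.prems by (simp add: copy_machine_def copy_command_def tape_of_snoc)
  then show ?case
    using Cons.IH[of "u @ [a]" "z @ [a]"] Cons.prems by (simp add: funpow_swap1 del: step.simps)
qed

text \<open>Each component takes one step per symbol and one for its end mark, which adds up to
  exactly \<open>length w\<close> steps.\<close>

lemma copy_machine_correct:
  assumes "5 \<notin> set w0" "5 \<notin> set w1" "5 \<notin> set w2"
  defines "w \<equiv> w0 @ [5] @ w1 @ [5] @ w2 @ [5]"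
  shows "computes_within 2 copy_machine w w2 (length w)"
proof -
  let ?M = "step copy_machine"
  define u where "u = w0 @ [5] @ w1 @ [5]"
  have start: "start_config 2 w = (0, [(tape_of w, 0), (tape_of [], 0)])"
    by (simp add: start_config_def)
  have 1: "(?M ^^ Suc (length w0)) (0, [(tape_of w, 0), (tape_of [], 0)])
      = (1, [(tape_of w, length (w0 @ [5])), (tape_of [], 0)])"
    using skip_component[of 0 w0 "[]"] assms(1) by (simp add: w_def)
  have 2: "(?M ^^ Suc (length w1)) (1, [(tape_of w, length (w0 @ [5])), (tape_of [], 0)])
      = (2, [(tape_of w, length u), (tape_of [], 0)])"
    using skip_component[of 1 w1 "w0 @ [5]"] assms(2) by (simp add: w_def u_def numeral_2_eq_2)
  obtain p p' where 3: "(?M ^^ Suc (length w2)) (2, [(tape_of w, length u), (tape_of [], 0)])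
      = (3, [(tape_of w, p), (tape_of w2, p')])"
    using copy_component[of w2 u "[]" "[]"] assms(3) by (auto simp: w_def u_def)
  \<comment> \<open>The summands are in reverse order of execution, since \<open>funpow_add\<close>
    applies the right-hand power first.\<close>
  have "length w = Suc (length w2) + (Suc (length w1) + Suc (length w0))"
    by (simp add: w_def)
  then have "(?M ^^ length w) (start_config 2 w) = (3, [(tape_of w, p), (tape_of w2, p')])"
    unfolding start by (simp only: funpow_add comp_apply 1 2 3)
  then show ?thesis
    unfolding computes_within_def by (intro exI[of _ "length w"]) (simp add: copy_machine_def)
qed


section \<open>Symbols of the encoding\<close>

lemma set_bin: "set (bin n) \<subseteq> {1, 2}"
proof (induction n rule: bin.induct)
  case (1 n)
  then show ?case
    by (subst bin.simps) auto
qed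

lemma set_enc_rat: "set (enc_rat x) \<subseteq> {1, 2, 6}"
  using set_bin by (fastforce simp: enc_rat_def split: prod.split)

text \<open>The absence of \<open>5\<close> makes the end marks of components unambiguous; the
  absence of \<open>0\<close> keeps blanks out of the words.\<close>

lemma set_enc_section:
  assumes "\<And>w. w \<in> set ws \<Longrightarrow> set w \<subseteq> {1, 2, 6}"
  shows "set (enc_section ws) \<subseteq> {1, 2, 3, 4, 6}"
proof -
  have "set w \<subseteq> {1, 2, 3, 4, 6}" if "w \<in> set ws" for w
    using assms[OF that] by auto
  then show ?thesis
    unfolding enc_section_def by auto
qed

lemma set_enc_section_bin: "set (enc_section (map (\<lambda>x. bin (g x)) xs)) \<subseteq> {1, 2, 3, 4, 6}"
  using set_bin by (intro set_enc_section) fastforce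

lemma set_enc_solution: "set (enc_solution I s) \<subseteq> {1, 2, 3, 4, 6}"
  using set_enc_section_bin[of "\<lambda>x. x"] set_enc_section_bin
  by (cases s) (simp del: insert_subset)

lemma set_enc_instance: "set (enc_instance I) \<subseteq> {1, 2, 3, 4, 6}"
proof -
  let ?Fs = "sorted_list_of_set (facs I)"
  let ?Ps = "map Inl ?Fs @ map Inr (sorted_list_of_set (clients I))"
  have "set (enc_section [enc_rat (distance I x y). x \<leftarrow> ?Ps, y \<leftarrow> ?Ps]) \<subseteq> {1, 2, 3, 4, 6}"
    using set_enc_rat by (intro set_enc_section) fastforce
  moreover have "set (enc_section (map (\<lambda>i. enc_rat (fac_cost I i)) ?Fs)) \<subseteq> {1, 2, 3, 4, 6}"
    using set_enc_rat by (intro set_enc_section) fastforce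
  ultimately show ?thesis
    unfolding enc_instance_def Let_def set_append
    using set_enc_section_bin[of "\<lambda>x. x"] set_enc_section_bin by (intro Un_least) simp_all
qed

lemma polytime_last_solution:
  "polytime_on rational_inputs enc_input (\<lambda>(I, s0, s1). enc_solution I s1)"
proof -
  \<comment> \<open>The polynomial \<open>[:0, 1:]\<close> is the identity, so the time bound is
    linear.\<close>
  have "set (enc_input x) \<subseteq> {0<..<7} \<and>
      set (case x of (I, s0, s1) \<Rightarrow> enc_solution I s1) \<subseteq> {0<..<7} \<and>
      computes_within 2 copy_machine (enc_input x) (case x of (I, s0, s1) \<Rightarrow> enc_solution I s1)
        (poly [:0, 1:] (length (enc_input x)))" for x
  proof -
    obtain I s0 s1 where x: "x = (I, s0, s1)" by (cases x)
    note subs = set_enc_instance[of I] set_enc_solution[of I s0] set_enc_solution[of I s1]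
    have "5 \<notin> set (enc_instance I)" "5 \<notin> set (enc_solution I s0)" "5 \<notin> set (enc_solution I s1)"
      using subs by auto
    note copy = copy_machine_correct[OF this]
    have "{1, 2, 3, 4, 6} \<subseteq> {0<..<7 :: nat}" by simp
    then show ?thesis
      using copy subs unfolding x by (auto dest: subsetD)
  qed
  then show ?thesis
    unfolding polytime_on_def using turing_machine_copy by blast
qed

theorem theorem2:
  shows "\<exists>A :: (nat, nat) lbfl \<Rightarrow> (nat, nat) solution \<Rightarrow> (nat, nat) solution \<Rightarrow> (nat, nat) solution.
    polytime_on rational_inputs enc_input (\<lambda>(I, s0, s1). enc_solution I (A I s0 s1)) \<and>
    (\<forall>(I :: (nat, nat) lbfl) (\<beta> :: real) (\<alpha>1 :: real) s0 s1.
       lbfl_instance I \<longrightarrow>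
       1 / 2 < \<beta> \<longrightarrow> \<beta> < 1 \<longrightarrow>
       0 \<le> \<alpha>1 \<longrightarrow>
       s0 \<in> covered_solutions \<beta> I \<longrightarrow>
       cost I s0 \<le> 2 / (1 - \<beta>) * OPT I \<longrightarrow>
       nearest_assignment I s0 \<longrightarrow>
       s1 \<in> approx_solutions \<alpha>1 (moved_instance I s0) \<longrightarrow>
       A I s0 s1 \<in> approx_solutions (\<alpha>1 * (1 + 2 / (1 - \<beta>)) + 2 / (1 - \<beta>)) I)"
proof (intro exI[of _ "\<lambda>I s0 s1. s1"] conjI allI impI)
  show "polytime_on rational_inputs enc_input (\<lambda>(I, s0, s1). enc_solution I s1)"
    by (rule polytime_last_solution)
next
  fix I :: "(nat, nat) lbfl" and \<beta> \<alpha>1 :: real and s0 s1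
  assume "lbfl_instance I" "0 \<le> \<alpha>1" "s0 \<in> covered_solutions \<beta> I"
    "cost I s0 \<le> 2 / (1 - \<beta>) * OPT I" "s1 \<in> approx_solutions \<alpha>1 (moved_instance I s0)"
  then show "s1 \<in> approx_solutions (\<alpha>1 * (1 + 2 / (1 - \<beta>)) + 2 / (1 - \<beta>)) I"
    \<comment> \<open>The lemma is used with \<open>2 / (1 - \<beta>)\<close> for
      \<open>\<gamma>\<close>.\<close>
    by (intro approx_solution_of_moved_instance) (auto simp: covered_solutions_def)
qed

end
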